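(* For every instance of the homogeneous MCST problem there is a revenue-ordered assortment that is optimal.
   Context: Products are $\mathcal N=\{1,\dots,n\}$; $0$ denotes the no-purchase option. Product $j$ has revenue $r_j$ (a real number), sorted so that $r_1\ge r_2\ge\cdots\ge r_n$. Arrival probabilities satisfy $\lambda_j\ge0$, $\sum_{j=1}^n\lambda_j=1$; homogeneous transition weights satisfy $v_i\ge0$ for $i\in\mathcal N\cup\{0\}$, $\sum_{i=0}^n v_i=1$. Homogeneous MCST problem: choose an offered assortment $S\subseteq\mathcal N$ and, for each $j\in\mathcal N\setminus S$, a recommended set $R_j\subseteq S$, maximizing the expected revenue $$\mathbf R(S,\{R_j\}_{j\notin S})=\sum_{i\in S}\lambda_i r_i+\sum_{j\notin S}\lambda_j\frac{\sum_{i\in R_j}r_iv_i}{\sum_{i\in R_j}v_i+v_0},$$ with the convention $0/0=0$. An assortment $S$ is optimal if it attains the maximum for some choice of recommended sets. A revenue-ordered assortment is a set of the form $\{1,\dots,t\}$ with $0\le t\le n$ (the empty set for $t=0$). *)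

theory Defs
  imports Complex_Main
begin

text \<open>Products are the natural numbers 1, ..., n, and index 0 of the weight function is the
  no-purchase option. Revenues may be negative, and they are sorted in weakly decreasing order.\<close>

definition hom_mcst_instance ::
  "nat \<Rightarrow> (nat \<Rightarrow> real) \<Rightarrow> (nat \<Rightarrow> real) \<Rightarrow> (nat \<Rightarrow> real) \<Rightarrow> bool" where
  "hom_mcst_instance n r lam v \<longleftrightarrow>
     (\<forall>i\<in>{1..n}. \<forall>j\<in>{1..n}. i \<le> j \<longrightarrow> r j \<le> r i) \<and>
     (\<forall>j\<in>{1..n}. 0 \<le> lam j) \<and> (\<Sum>j\<in>{1..n}. lam j) = 1 \<and>
     (\<forall>i\<in>{0..n}. 0 \<le> v i) \<and> (\<Sum>i\<in>{0..n}. v i) = 1"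

definition mcst_feasible :: "nat \<Rightarrow> nat set \<Rightarrow> (nat \<Rightarrow> nat set) \<Rightarrow> bool" where
  "mcst_feasible n S R \<longleftrightarrow> S \<subseteq> {1..n} \<and> (\<forall>j\<in>{1..n} - S. R j \<subseteq> S)"

text \<open>The convention \<open>0/0 = 0\<close> is that of division on the reals: for nonnegative weights
  the numerator vanishes whenever the denominator does.\<close>

definition mcst_revenue ::
  "nat \<Rightarrow> (nat \<Rightarrow> real) \<Rightarrow> (nat \<Rightarrow> real) \<Rightarrow> (nat \<Rightarrow> real) \<Rightarrow> nat set \<Rightarrow> (nat \<Rightarrow> nat set) \<Rightarrow> real" where
  "mcst_revenue n r lam v S R =
     (\<Sum>i\<in>S. lam i * r i) +
     (\<Sum>j\<in>{1..n} - S. lam j * ((\<Sum>i\<in>R j. r i * v i) / ((\<Sum>i\<in>R j. v i) + v 0)))"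

definition mcst_optimal ::
  "nat \<Rightarrow> (nat \<Rightarrow> real) \<Rightarrow> (nat \<Rightarrow> real) \<Rightarrow> (nat \<Rightarrow> real) \<Rightarrow> nat set \<Rightarrow> bool" where
  "mcst_optimal n r lam v S \<longleftrightarrow>
     (\<exists>R. mcst_feasible n S R \<and>
       (\<forall>S' R'. mcst_feasible n S' R' \<longrightarrow>
          mcst_revenue n r lam v S' R' \<le> mcst_revenue n r lam v S R))"

definition revenue_ordered :: "nat \<Rightarrow> nat set \<Rightarrow> bool" where
  "revenue_ordered n S \<longleftrightarrow> (\<exists>t. t \<le> n \<and> S = {1..t})"

end

theory Submission imports Defs begin

text \<open>Transition weights do not depend on the product that is missing, so every customer whose
  product is not offered is best served by the same recommended set: one that maximizes the
  attraction ratio \<open>q\<close> over the subsets of \<open>S\<close>. Write \<open>z\<close> for this maximum; an arriving customer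
  is then worth \<open>r i\<close> if \<open>i \<in> S\<close> and \<open>z\<close> otherwise, hence at most \<open>max (r i) z\<close>.

  The assortment \<open>T\<close> of all products with revenue at least \<open>z\<close> reaches this upper bound. A product
  with revenue below \<open>z\<close> only dilutes a recommended set of ratio \<open>z\<close>, so
  such products can be dropped from it without lowering the ratio
  (\<open>recommendation_ratio_truncate\<close>). What remains lies in \<open>T\<close>, so customers whose product is
  outside \<open>T\<close> are still worth at least \<open>z\<close>. As \<open>r\<close> is decreasing, \<open>T\<close> is revenue-ordered
  (\<open>revenue_threshold_is_initial_segment\<close>). Hence every assortment is dominated by a
  revenue-ordered one (\<open>revenue_ordered_dominates\<close>), and the best of
  the \<open>n + 1\<close> revenue-ordered assortments is optimal.\<close>

definition recommendation_ratio :: "(nat \<Rightarrow> real) \<Rightarrow> (nat \<Rightarrow> real) \<Rightarrow> nat set \<Rightarrow> real" where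
  "recommendation_ratio r v A = (\<Sum>i\<in>A. r i * v i) / ((\<Sum>i\<in>A. v i) + v 0)"

definition best_ratio :: "(nat \<Rightarrow> real) \<Rightarrow> (nat \<Rightarrow> real) \<Rightarrow> nat set \<Rightarrow> real" where
  "best_ratio r v S = Max (recommendation_ratio r v ` Pow S)"

definition assortment_value ::
  "nat \<Rightarrow> (nat \<Rightarrow> real) \<Rightarrow> (nat \<Rightarrow> real) \<Rightarrow> (nat \<Rightarrow> real) \<Rightarrow> nat set \<Rightarrow> real" where
  "assortment_value n r lam v S =
     (\<Sum>i\<in>S. lam i * r i) + (\<Sum>j\<in>{1..n} - S. lam j * best_ratio r v S)"

lemma recommendation_ratio_le_best:
  assumes "finite S" "A \<subseteq> S"
  shows "recommendation_ratio r v A \<le> best_ratio r v S"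
  unfolding best_ratio_def using assms by (intro Max_ge) auto

lemma best_ratio_attained:
  assumes "finite S"
  obtains A where "A \<subseteq> S" "recommendation_ratio r v A = best_ratio r v S"
proof -
  have "best_ratio r v S \<in> recommendation_ratio r v ` Pow S"
    unfolding best_ratio_def using assms by (intro Max_in) auto
  then show thesis using that by auto
qed

text \<open>Clearing a nonzero denominator, \<open>A\<close> has ratio \<open>z\<close> iff the surpluses \<open>(r i - z) * v i\<close> over
  \<open>A\<close> add up to \<open>z * v 0\<close>. Dropping the products with \<open>r i < z\<close> removes only nonpositive terms from this sum,
  which therefore stays at least \<open>z * v 0\<close>; dividing back gives a ratio of at least \<open>z\<close>. The
  delicate point is that either denominator may vanish.\<close>
lemma recommendation_ratio_truncate:
  assumes fin: "finite A" and v0: "0 \<le> v 0" and v: "\<And>i. i \<in> A \<Longrightarrow> 0 \<le> v i"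
    and z: "z = recommendation_ratio r v A"
  shows "z \<le> recommendation_ratio r v {i \<in> A. z \<le> r i}"
proof -
  let ?B = "{i \<in> A. z \<le> r i}"
  have surplus: "(\<Sum>i\<in>A. (r i - z) * v i) = (\<Sum>i\<in>A. r i * v i) - z * (\<Sum>i\<in>A. v i)"
    "(\<Sum>i\<in>?B. (r i - z) * v i) = (\<Sum>i\<in>?B. r i * v i) - z * (\<Sum>i\<in>?B. v i)"
    by (simp_all add: left_diff_distrib sum_subtractf sum_distrib_left)
  have low: "(r i - z) * v i \<le> 0" if "i \<in> A - ?B" for i
    using that v by (auto intro!: mult_nonpos_nonneg)
  have split: "(\<Sum>i\<in>A. (r i - z) * v i)
      = (\<Sum>i\<in>A - ?B. (r i - z) * v i) + (\<Sum>i\<in>?B. (r i - z) * v i)"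
    using fin by (intro sum.subset_diff) auto
  have B_nonneg: "0 \<le> (\<Sum>i\<in>?B. v i)" using v by (intro sum_nonneg) auto
  show ?thesis
  proof (cases "(\<Sum>i\<in>A. v i) + v 0 = 0")
    case True
    \<comment> \<open>All weights on \<open>A\<close> vanish as well, so both ratios are 0.\<close>
    have "0 \<le> (\<Sum>i\<in>A. v i)" using v by (intro sum_nonneg) auto
    then have "(\<Sum>i\<in>A. v i) = 0" using True v0 by linarith
    then have "\<forall>i\<in>A. v i = 0" using fin v by (simp add: sum_nonneg_eq_0_iff)
    then show ?thesis by (simp add: z recommendation_ratio_def)
  next
    case False
    then have total: "(\<Sum>i\<in>A. (r i - z) * v i) = z * v 0"
      unfolding surplus by (simp add: z recommendation_ratio_def field_simps)
    show ?thesis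
    proof (cases "(\<Sum>i\<in>?B. v i) + v 0 = 0")
      case True
      \<comment> \<open>The surviving products and the no-purchase option have no weight, so \<open>z\<close> would be an
        average of revenues that are all below \<open>z\<close>.\<close>
      then have v00: "v 0 = 0" and "(\<Sum>i\<in>?B. v i) = 0" using v0 B_nonneg by linarith+
      then have B0: "\<forall>i\<in>?B. v i = 0" using fin v by (subst (asm) sum_nonneg_eq_0_iff) auto
      then have "(\<Sum>i\<in>A - ?B. (r i - z) * v i) = 0" using split total v00 by simp
      then have "(\<Sum>i\<in>A - ?B. - ((r i - z) * v i)) = 0" by (simp only: sum_negf)
      then have "\<forall>i\<in>A - ?B. - ((r i - z) * v i) = 0"
        using fin low by (subst (asm) sum_nonneg_eq_0_iff) auto
      then have "\<forall>i\<in>A - ?B. v i = 0" by auto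
      with B0 have "(\<Sum>i\<in>A. v i) = 0" by (intro sum.neutral) blast
      with v00 False show ?thesis by simp
    next
      case den: False
      have "(\<Sum>i\<in>A - ?B. (r i - z) * v i) \<le> 0" using low by (intro sum_nonpos)
      then have "z * v 0 \<le> (\<Sum>i\<in>?B. r i * v i) - z * (\<Sum>i\<in>?B. v i)"
        using split total surplus by linarith
      then have "z * ((\<Sum>i\<in>?B. v i) + v 0) \<le> (\<Sum>i\<in>?B. r i * v i)" by (simp add: algebra_simps)
      moreover have "0 < (\<Sum>i\<in>?B. v i) + v 0" using den B_nonneg v0 by linarith
      ultimately show ?thesis by (simp add: recommendation_ratio_def pos_le_divide_eq)
    qed
  qed
qed

lemma revenue_threshold_is_initial_segment:
  fixes r :: "nat \<Rightarrow> real"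
  assumes "\<And>i j. 1 \<le> i \<Longrightarrow> i \<le> j \<Longrightarrow> j \<le> n \<Longrightarrow> r j \<le> r i"
  shows "\<exists>t\<le>n. {i \<in> {1..n}. z \<le> r i} = {1..t}"
  using assms
proof (induction n)
  case (Suc n)
  show ?case
  proof (cases "z \<le> r (Suc n)")
    case True
    have "{i \<in> {1..Suc n}. z \<le> r i} = {1..Suc n}"
      using True Suc.prems by (auto intro: order_trans)
    then show ?thesis by blast
  next
    case False
    then have "{i \<in> {1..Suc n}. z \<le> r i} = {i \<in> {1..n}. z \<le> r i}" by (auto simp: le_Suc_eq)
    then show ?thesis using Suc by (metis le_Suc_eq)
  qed
qed simp

text \<open>The threshold is the best ratio \<open>z\<close> of \<open>S\<close> itself; both values are then compared with
  the sum of \<open>lam i * max (r i) z\<close>.\<close>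
lemma revenue_ordered_dominates:
  assumes inst: "hom_mcst_instance n r lam v" and S: "S \<subseteq> {1..n}"
  shows "\<exists>t\<le>n. assortment_value n r lam v S \<le> assortment_value n r lam v {1..t}"
proof -
  have lam: "0 \<le> lam j" if "j \<in> {1..n}" for j
    using inst that by (auto simp: hom_mcst_instance_def)
  define z where "z = best_ratio r v S"
  let ?T = "{i \<in> {1..n}. z \<le> r i}"
  have finS: "finite S" using S finite_subset by blast
  obtain A where A: "A \<subseteq> S" "recommendation_ratio r v A = z"
    using best_ratio_attained[OF finS] unfolding z_def by metis
  have "z \<le> recommendation_ratio r v {i \<in> A. z \<le> r i}"
    using A S finS inst finite_subset[OF A(1) finS]
    by (intro recommendation_ratio_truncate) (auto simp: hom_mcst_instance_def)
  also have "\<dots> \<le> best_ratio r v ?T"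
    using A S by (intro recommendation_ratio_le_best) auto
  finally have zT: "z \<le> best_ratio r v ?T" .
  have split: "(\<Sum>i\<in>{1..n}. f i) = (\<Sum>i\<in>U. f i) + (\<Sum>i\<in>{1..n} - U. f i)"
    if "U \<subseteq> {1..n}" for U and f :: "nat \<Rightarrow> real"
    using sum.subset_diff[OF that] by (simp add: add.commute)
  have "assortment_value n r lam v S
      \<le> (\<Sum>i\<in>S. lam i * max (r i) z) + (\<Sum>i\<in>{1..n} - S. lam i * max (r i) z)"
    unfolding assortment_value_def z_def[symmetric]
    using S lam by (intro add_mono sum_mono mult_left_mono) auto
  also have "\<dots> = (\<Sum>i\<in>{1..n}. lam i * max (r i) z)" using split[OF S] by simp
  also have "\<dots> = (\<Sum>i\<in>?T. lam i * max (r i) z) + (\<Sum>i\<in>{1..n} - ?T. lam i * max (r i) z)"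
    by (intro split) auto
  also have "\<dots> \<le> assortment_value n r lam v ?T"
    unfolding assortment_value_def
    using lam zT by (intro add_mono sum_mono mult_left_mono) auto
  finally have "assortment_value n r lam v S \<le> assortment_value n r lam v ?T" .
  moreover have "\<exists>t\<le>n. ?T = {1..t}"
    using inst by (intro revenue_threshold_is_initial_segment) (auto simp: hom_mcst_instance_def)
  ultimately show ?thesis by metis
qed

lemma mcst_revenue_le_assortment_value:
  assumes inst: "hom_mcst_instance n r lam v" and feas: "mcst_feasible n S R"
  shows "mcst_revenue n r lam v S R \<le> assortment_value n r lam v S"
proof -
  have "S \<subseteq> {1..n}" using feas by (simp add: mcst_feasible_def)
  then have "finite S" using finite_subset by blast
  then show ?thesis
    unfolding mcst_revenue_def assortment_value_def recommendation_ratio_def[symmetric]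
    using inst feas
    by (intro add_left_mono sum_mono mult_left_mono recommendation_ratio_le_best)
       (auto simp: hom_mcst_instance_def mcst_feasible_def)
qed

lemma assortment_value_attained:
  assumes S: "S \<subseteq> {1..n}"
  shows "\<exists>R. mcst_feasible n S R \<and> mcst_revenue n r lam v S R = assortment_value n r lam v S"
proof -
  have "finite S" using S finite_subset by blast
  then obtain A where "A \<subseteq> S" "recommendation_ratio r v A = best_ratio r v S"
    using best_ratio_attained by metis
  then show ?thesis using S
    by (intro exI[of _ "\<lambda>_. A"])
       (simp add: mcst_feasible_def mcst_revenue_def assortment_value_def
          recommendation_ratio_def)
qed

theorem corollary1:
  fixes n :: nat and r lam v :: "nat \<Rightarrow> real"
  assumes "hom_mcst_instance n r lam v"
  shows "\<exists>S. revenue_ordered n S \<and> mcst_optimal n r lam v S"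
proof -
  let ?val = "assortment_value n r lam v"
  have "Max ((\<lambda>t. ?val {1..t}) ` {..n}) \<in> (\<lambda>t. ?val {1..t}) ` {..n}"
    by (intro Max_in) auto
  then obtain t where t: "t \<le> n" and "?val {1..t} = Max ((\<lambda>t. ?val {1..t}) ` {..n})"
    by (metis (no_types, lifting) imageE atMost_iff)
  then have best: "?val {1..s} \<le> ?val {1..t}" if "s \<le> n" for s
    using that by simp
  obtain R where R: "mcst_feasible n {1..t} R" "mcst_revenue n r lam v {1..t} R = ?val {1..t}"
    using assortment_value_attained[of "{1..t}" n r lam v] t by auto
  have "mcst_revenue n r lam v S' R' \<le> mcst_revenue n r lam v {1..t} R"
    if feas: "mcst_feasible n S' R'" for S' R'
  proof -
    have "S' \<subseteq> {1..n}" using feas by (simp add: mcst_feasible_def)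
    then obtain s where "s \<le> n" "?val S' \<le> ?val {1..s}"
      using revenue_ordered_dominates[OF assms] by blast
    with best mcst_revenue_le_assortment_value[OF assms feas] R(2) show ?thesis
      by (metis order_trans)
  qed
  then show ?thesis using t R(1) unfolding mcst_optimal_def revenue_ordered_def by blast
qed

end
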